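(* Let $\mathsf{n}$ be a tuple of linear subspaces of a finite-dimensional vector space $V$ over a field $\mathbb{K}$. Then $\mathsf{n}$ is essential if and only if $\mathsf{n}$ is cyclic.
   Context: A tuple is a finite indexed family of linear subspaces of $V$ (repetitions allowed); a subtuple is a subfamily indexed by a subset of the index set. For a tuple $\mathsf{k}$, $\langle\mathsf{k}\rangle=\sum_{L\in\mathsf{k}}L$ (zero for the empty tuple), $\mathfrak{c}(\mathsf{k})$ is the number of its entries, and $\delta(\mathsf{k})=\dim\langle\mathsf{k}\rangle-\mathfrak{c}(\mathsf{k})$ is its defect. A tuple is linearly independent if every subtuple (including itself) has non-negative defect. A tuple is essential if every proper subtuple has strictly higher defect than the whole tuple. The Minkowski matroid $\mathsf{M}(\mathsf{n})$ has ground set the entries (indices) of $\mathsf{n}$ and independent sets the linearly independent subtuples; its circuits are the minimal linearly dependent subtuples. A tuple $\mathsf{n}$ is cyclic if it is a union of circuits of $\mathsf{M}(\mathsf{n})$. *)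

theory Defs
  imports HOL.Vector_Spaces "HOL-Library.Set_Algebras"
begin

text \<open>
  The ambient space \<open>V\<close> is the type \<open>'v\<close> with scalar multiplication \<open>scale\<close>.
  A tuple is a family \<open>L\<close> restricted to a finite index set, and its subtuples are given by the
  subsets of that index set.  Only the values of \<open>L\<close> on the index set matter.
\<close>

definition is_tuple ::
    "('k::field \<Rightarrow> 'v::ab_group_add \<Rightarrow> 'v) \<Rightarrow> ('i \<Rightarrow> 'v set) \<Rightarrow> 'i set \<Rightarrow> bool" where
  "is_tuple scale L I \<longleftrightarrow> finite I \<and> (\<forall>i\<in>I. module.subspace scale (L i))"

text \<open>The sum below is the elementwise (Minkowski) sum of sets; over \<open>J = {}\<close> it is \<open>{0}\<close>.\<close>

definition tuple_sum :: "('i \<Rightarrow> 'v::ab_group_add set) \<Rightarrow> 'i set \<Rightarrow> 'v set" where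
  "tuple_sum L J = (\<Sum>i\<in>J. L i)"

definition defect ::
    "('k::field \<Rightarrow> 'v::ab_group_add \<Rightarrow> 'v) \<Rightarrow> ('i \<Rightarrow> 'v set) \<Rightarrow> 'i set \<Rightarrow> int" where
  "defect scale L J = int (vector_space.dim scale (tuple_sum L J)) - int (card J)"

definition lin_indep_tuple ::
    "('k::field \<Rightarrow> 'v::ab_group_add \<Rightarrow> 'v) \<Rightarrow> ('i \<Rightarrow> 'v set) \<Rightarrow> 'i set \<Rightarrow> bool" where
  "lin_indep_tuple scale L J \<longleftrightarrow> (\<forall>K. K \<subseteq> J \<longrightarrow> 0 \<le> defect scale L K)"

definition essential ::
    "('k::field \<Rightarrow> 'v::ab_group_add \<Rightarrow> 'v) \<Rightarrow> ('i \<Rightarrow> 'v set) \<Rightarrow> 'i set \<Rightarrow> bool" where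
  "essential scale L I \<longleftrightarrow> (\<forall>J. J \<subset> I \<longrightarrow> defect scale L I < defect scale L J)"

text \<open>The Minkowski matroid has ground set \<open>I\<close> and independence predicate
  \<open>lin_indep_tuple scale L\<close> on the subsets of \<open>I\<close>.\<close>

definition circuits :: "'i set \<Rightarrow> ('i set \<Rightarrow> bool) \<Rightarrow> 'i set set" where
  "circuits E indep = {C. C \<subseteq> E \<and> \<not> indep C \<and> (\<forall>D. D \<subset> C \<longrightarrow> indep D)}"

definition minkowski_circuits ::
    "('k::field \<Rightarrow> 'v::ab_group_add \<Rightarrow> 'v) \<Rightarrow> ('i \<Rightarrow> 'v set) \<Rightarrow> 'i set \<Rightarrow> 'i set set" where
  "minkowski_circuits scale L I = circuits I (lin_indep_tuple scale L)"

text \<open>The empty union is allowed, so the empty tuple is cyclic.\<close>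

definition cyclic ::
    "('k::field \<Rightarrow> 'v::ab_group_add \<Rightarrow> 'v) \<Rightarrow> ('i \<Rightarrow> 'v set) \<Rightarrow> 'i set \<Rightarrow> bool" where
  "cyclic scale L I \<longleftrightarrow> (\<exists>\<C>. \<C> \<subseteq> minkowski_circuits scale L I \<and> I = \<Union>\<C>)"

end

theory Submission
  imports Defs
begin

text \<open>
  The defect \<open>\<delta>\<close> is submodular, vanishes on the empty tuple, and drops by at most one when an
  entry is added; the equivalence holds for every set function with these properties.

  If \<open>C\<close> is a circuit and \<open>C\<close> is not contained in \<open>J\<close>, then \<open>\<delta> (J \<inter> C) > \<delta> C\<close>, so submodularity
  gives \<open>\<delta> (J \<union> C) < \<delta> J\<close>; adding circuits one after another leads from \<open>J\<close> to the whole tuple.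

  Conversely, suppose that the tuple \<open>I\<close> is essential but that \<open>i\<close> lies in no circuit.  Take a
  maximal independent subset \<open>B\<close> of \<open>I - {i}\<close>.  Each \<open>e\<close> outside \<open>B \<union> {i}\<close> lies in a subset of
  \<open>B \<union> {e}\<close> of negative defect, and by submodularity the union of these subsets has defect at most
  \<open>- m\<close>, where \<open>m = card (I - {i} - B)\<close>.  Hence \<open>\<delta> I < - m\<close>.  But \<open>B \<union> {i}\<close> contains no circuit,
  so its defect is non-negative, whence \<open>\<delta> I \<ge> - m\<close>.
\<close>

locale defect_function =
  fixes I :: "'i set" and f :: "'i set \<Rightarrow> int"
  assumes finite_ground: "finite I"
    and f_empty: "f {} = 0"
    and submodular: "\<lbrakk>A \<subseteq> I; B \<subseteq> I\<rbrakk> \<Longrightarrow> f (A \<union> B) + f (A \<inter> B) \<le> f A + f B"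
    and drop_le: "\<lbrakk>A \<subseteq> B; B \<subseteq> I\<rbrakk> \<Longrightarrow> f A \<le> f B + int (card (B - A))"
begin

definition indep :: "'i set \<Rightarrow> bool" where
  "indep J \<longleftrightarrow> (\<forall>K\<subseteq>J. 0 \<le> f K)"

text \<open>Some subset of a dependent set has negative value. In a circuit this can only be the
  circuit itself, because proper subsets are independent and so have non-negative value.\<close>

lemma circuit_less:
  assumes "C \<in> circuits I indep" "D \<subset> C"
  shows "f C < f D"
proof -
  have "\<not> indep C" and proper: "\<And>D. D \<subset> C \<Longrightarrow> indep D"
    using assms(1) by (auto simp: circuits_def)
  then obtain K where K: "K \<subseteq> C" "f K < 0"
    by (auto simp: indep_def not_le)
  have "K = C"
    using K proper[of K] by (force simp: indep_def)
  moreover have "0 \<le> f D"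
    using proper[OF assms(2)] by (auto simp: indep_def)
  ultimately show ?thesis
    using K by simp
qed

lemma Un_circuit_less:
  assumes "C \<in> circuits I indep" "J \<subseteq> I" "\<not> C \<subseteq> J"
  shows "f (J \<union> C) < f J"
proof -
  have "f C < f (J \<inter> C)"
    using assms by (intro circuit_less) auto
  moreover have "f (J \<union> C) + f (J \<inter> C) \<le> f J + f C"
    using assms by (intro submodular) (auto simp: circuits_def)
  ultimately show ?thesis
    by linarith
qed

lemma less_of_Union_circuits:
  assumes "\<C> \<subseteq> circuits I indep" "I = \<Union>\<C>" "J \<subset> I"
  shows "f I < f J"
  using assms(3)
proof (induction "card (I - J)" arbitrary: J rule: less_induct)
  case less
  from less.prems assms(2) obtain C where C: "C \<in> \<C>" "\<not> C \<subseteq> J"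
    by blast
  have CI: "C \<subseteq> I"
    using C assms(2) by blast
  have step: "f (J \<union> C) < f J"
    using C assms(1) less.prems by (intro Un_circuit_less) auto
  show ?case
  proof (cases "J \<union> C = I")
    case True
    then show ?thesis
      using step by simp
  next
    case False
    \<comment> \<open>\<open>C\<close> supplies at least one entry missing from \<open>J\<close>, so
      the induction measure drops.\<close>
    have "card (I - (J \<union> C)) < card (I - J)"
      using C CI finite_ground by (intro psubset_card_mono) auto
    then have "f I < f (J \<union> C)"
      using less.hyps[of "J \<union> C"] False CI less.prems by auto
    then show ?thesis
      using step by simp
  qed
qed

lemma circuit_exists:
  assumes "A \<subseteq> I" "\<not> indep A"
  obtains C where "C \<in> circuits I indep" "C \<subseteq> A"
proof -
  have "finite {D. D \<subseteq> A \<and> \<not> indep D}"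
    using assms(1) finite_ground by (simp add: finite_subset)
  then obtain C where C: "C \<subseteq> A" "\<not> indep C"
    and min: "\<And>D. \<lbrakk>D \<subseteq> A; \<not> indep D; D \<subseteq> C\<rbrakk> \<Longrightarrow> D = C"
    using finite_has_minimal[of "{D. D \<subseteq> A \<and> \<not> indep D}"] assms(2)
    by (simp add: Ball_def) (metis order_refl)
  have "C \<in> circuits I indep"
    unfolding circuits_def
  proof (intro CollectI conjI allI impI)
    fix D
    assume "D \<subset> C"
    then show "indep D"
      using min[of D] C(1) by auto
  qed (use C assms(1) in auto)
  with C(1) show ?thesis
    by (rule that[rotated])
qed

lemma neg_superset_of_maximal_indep:
  assumes "B \<union> E \<subseteq> I" "indep B" "\<And>e. e \<in> E \<Longrightarrow> \<not> indep (insert e B)"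
    and "B \<inter> E = {}"
  shows "\<exists>J\<subseteq>B \<union> E. f J \<le> - int (card E)"
proof -
  have "finite E"
    using assms(1) finite_ground finite_subset by blast
  then show ?thesis
    using assms
  proof (induction E)
    case empty
    then show ?case
      using f_empty by (intro exI[of _ "{}"]) simp
  next
    case (insert e E)
    then obtain J where J: "J \<subseteq> B \<union> E" "f J \<le> - int (card E)"
      by auto
    obtain K where K: "K \<subseteq> insert e B" "f K < 0"
      using insert.prems(3)[of e] by (auto simp: indep_def not_le)
    \<comment> \<open>The only entry of \<open>K\<close> that may lie outside \<open>B\<close> is
      \<open>e\<close>, and \<open>e\<close> is in neither \<open>B\<close> nor \<open>E\<close>,
      hence not in \<open>J\<close>.\<close>
    have "J \<inter> K \<subseteq> B"
      using J K insert by auto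
    then have "0 \<le> f (J \<inter> K)"
      using insert.prems(2) by (auto simp: indep_def)
    moreover have "f (J \<union> K) + f (J \<inter> K) \<le> f J + f K"
      using J K insert.prems(1) by (intro submodular) auto
    ultimately have "f (J \<union> K) \<le> - int (card (insert e E))"
      using J K insert.hyps by simp
    moreover have "J \<union> K \<subseteq> B \<union> insert e E"
      using J K by auto
    ultimately show ?case
      by blast
  qed
qed

lemma mem_circuit_of_less:
  assumes less: "\<And>J. J \<subset> I \<Longrightarrow> f I < f J" and i: "i \<in> I"
  shows "\<exists>C\<in>circuits I indep. i \<in> C"
proof (rule ccontr)
  assume no_circuit: "\<not> ?thesis"
  let ?\<B> = "{B. B \<subseteq> I - {i} \<and> indep B}"
  have "finite ?\<B>"
    using finite_ground by (simp add: finite_subset)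
  moreover have "{} \<in> ?\<B>"
    using f_empty by (auto simp: indep_def)
  ultimately obtain B where B: "B \<subseteq> I - {i}" "indep B"
    and maximal: "\<And>B'. \<lbrakk>B' \<subseteq> I - {i}; indep B'; B \<subseteq> B'\<rbrakk> \<Longrightarrow> B' = B"
    using finite_has_maximal[of ?\<B>] by (simp add: Ball_def) (metis empty_subsetI)
  have "indep (insert i B)"
  proof (rule ccontr)
    assume "\<not> indep (insert i B)"
    then obtain C where C: "C \<in> circuits I indep" "C \<subseteq> insert i B"
      using circuit_exists[of "insert i B"] B i by auto
    \<comment> \<open>A circuit avoids \<open>i\<close> by assumption.\<close>
    then have "C \<subseteq> B"
      using no_circuit by auto
    then have "indep C"
      using B(2) by (auto simp: indep_def)
    then show False
      using C by (auto simp: circuits_def)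
  qed
  then have "0 \<le> f (insert i B)"
    by (auto simp: indep_def)
  moreover define E where "E = I - insert i B"
  moreover have "f (insert i B) \<le> f I + int (card (I - insert i B))"
    using B i by (intro drop_le) auto
  ultimately have lower: "- int (card E) \<le> f I"
    by simp
  have "\<not> indep (insert e B)" if "e \<in> E" for e
    using maximal[of "insert e B"] that B by (auto simp: E_def)
  then have "\<exists>J\<subseteq>B \<union> E. f J \<le> - int (card E)"
    using B by (intro neg_superset_of_maximal_indep) (auto simp: E_def)
  then obtain J where J: "J \<subseteq> B \<union> E" "f J \<le> - int (card E)"
    by blast
  \<comment> \<open>Neither \<open>B\<close> nor \<open>E\<close> contains \<open>i\<close>, so
    \<open>J\<close> is a proper subset. This makes the upper bound on \<open>f I\<close> strict and
    contradicts \<open>lower\<close>.\<close>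
  have "J \<subset> I"
    using J(1) B i by (auto simp: E_def)
  then show False
    using less[of J] J(2) lower by simp
qed

theorem strict_minimum_iff_Union_circuits:
  "(\<forall>J. J \<subset> I \<longrightarrow> f I < f J) \<longleftrightarrow> (\<exists>\<C>\<subseteq>circuits I indep. I = \<Union>\<C>)"
proof
  assume "\<forall>J. J \<subset> I \<longrightarrow> f I < f J"
  then have "I \<subseteq> \<Union>(circuits I indep)"
    using mem_circuit_of_less by blast
  moreover have "\<Union>(circuits I indep) \<subseteq> I"
    by (auto simp: circuits_def)
  ultimately show "\<exists>\<C>\<subseteq>circuits I indep. I = \<Union>\<C>"
    by blast
next
  assume "\<exists>\<C>\<subseteq>circuits I indep. I = \<Union>\<C>"
  then show "\<forall>J. J \<subset> I \<longrightarrow> f I < f J"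
    using less_of_Union_circuits by blast
qed

end

text \<open>By induction, since the span of a union is the sum of the spans. The defect can then be
  computed from the dimension of a mere union of sets.\<close>

lemma (in vector_space) tuple_sum_eq_span:
  assumes "finite J" "\<And>i. i \<in> J \<Longrightarrow> subspace (L i)"
  shows "tuple_sum L J = span (\<Union>i\<in>J. L i)"
  using assms
proof (induction J)
  case empty
  then show ?case
    by (simp add: tuple_sum_def)
next
  case (insert j J)
  have "tuple_sum L (insert j J) = L j + tuple_sum L J"
    using insert.hyps by (simp add: tuple_sum_def)
  also have "\<dots> = span (L j) + span (\<Union>i\<in>J. L i)"
    using insert by (simp add: span_eq_iff[THEN iffD2])
  also have "\<dots> = span (\<Union>i\<in>insert j J. L i)"
    by (auto simp: span_Un set_plus_def)
  finally show ?case .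
qed

text \<open>The modular law for the subspaces \<open>span S\<close> and \<open>span T\<close>, whose
  sum is the span of \<open>S \<union> T\<close>.\<close>

lemma (in finite_dimensional_vector_space) dim_span_Un_Int_le:
  "dim (S \<union> T) + dim (span S \<inter> span T) \<le> dim S + dim T"
  using dim_sums_Int[of "span S" "span T"] dim_span[of "S \<union> T"]
  by (simp add: span_Un)

lemma (in finite_dimensional_vector_space) defect_function_defect:
  assumes "is_tuple scale L I"
  shows "defect_function I (defect scale L)"
proof
  have fin: "finite I" and sub: "\<And>i. i \<in> I \<Longrightarrow> subspace (L i)"
    using assms by (auto simp: is_tuple_def)
  show "finite I"
    by (rule fin)
  have defect: "defect scale L J = int (dim (\<Union>i\<in>J. L i)) - int (card J)" if "J \<subseteq> I" for J
    using that sub finite_subset[OF that fin]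
    by (subst defect_def, subst tuple_sum_eq_span) auto
  show "defect scale L {} = 0"
    by (simp add: defect)
  fix A B
  show "defect scale L (A \<union> B) + defect scale L (A \<inter> B) \<le> defect scale L A + defect scale L B"
    if "A \<subseteq> I" "B \<subseteq> I"
  proof -
    let ?A = "\<Union>i\<in>A. L i" and ?B = "\<Union>i\<in>B. L i"
    \<comment> \<open>Submodularity is only an inequality because the entries indexed by
      \<open>A \<inter> B\<close> may span less than the intersection of the two spans; cardinality
      is modular.\<close>
    have "dim (\<Union>i\<in>A \<inter> B. L i) \<le> dim (span ?A \<inter> span ?B)"
      by (intro dim_subset) (auto intro: span_base)
    then have "dim (\<Union>i\<in>A \<union> B. L i) + dim (\<Union>i\<in>A \<inter> B. L i) \<le> dim ?A + dim ?B"
      using dim_span_Un_Int_le[of ?A ?B] by (simp add: UN_Un)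
    moreover have "card A + card B = card (A \<union> B) + card (A \<inter> B)"
      using that fin by (intro card_Un_Int) (auto intro: finite_subset)
    moreover have "A \<union> B \<subseteq> I" "A \<inter> B \<subseteq> I"
      using that by auto
    ultimately show ?thesis
      using that by (simp add: defect)
  qed
  show "defect scale L A \<le> defect scale L B + int (card (B - A))" if "A \<subseteq> B" "B \<subseteq> I"
  proof -
    \<comment> \<open>Enlarging the index set cannot lower the dimension, so the defect falls at
      most by the number of new entries.\<close>
    have "dim (\<Union>i\<in>A. L i) \<le> dim (\<Union>i\<in>B. L i)"
      using that by (intro dim_subset) auto
    moreover have "card A + card (B - A) = card B"
      using that fin by (metis card_Diff_subset card_mono finite_subset le_add_diff_inverse)
    moreover have "A \<subseteq> I"
      using that by auto
    ultimately show ?thesis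
      using that by (simp add: defect)
  qed
qed

theorem theorem2p10:
  fixes scale :: "'k::field \<Rightarrow> 'v::ab_group_add \<Rightarrow> 'v"
    and Basis :: "'v set"
    and L :: "'i \<Rightarrow> 'v set"
    and I :: "'i set"
  assumes "finite_dimensional_vector_space scale Basis"
    and "is_tuple scale L I"
  shows "essential scale L I \<longleftrightarrow> cyclic scale L I"
proof -
  interpret D: defect_function I "defect scale L"
    using assms by (rule finite_dimensional_vector_space.defect_function_defect)
  have "D.indep = lin_indep_tuple scale L"
    by (auto simp: fun_eq_iff D.indep_def lin_indep_tuple_def)
  then show ?thesis
    using D.strict_minimum_iff_Union_circuits
    by (simp add: essential_def cyclic_def minkowski_circuits_def)
qed

end
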